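(* Let $a\ge 1$ and $k\ge 2$ be integers, and let $T=T[a,a+k-2;a+k,a+k+1]$ be the starlike tree whose arm lengths are $a,a+1,\ldots,a+k-2,a+k,a+k+1$ (i.e. the lengths $a,\ldots,a+k+1$ with $a+k-1$ removed). If $k\equiv 3\pmod 4$ or $k+2a\equiv 0\pmod 4$, then $T$ is transmission irregular.
   Context: The transmission of a vertex $v$ of a graph $G$ is ${\rm Tr}_G(v)=\sum_{u\in V(G)} d_G(u,v)$; $G$ is transmission irregular if all its vertices have pairwise different transmissions. A starlike tree with arm lengths $k_1,\ldots,k_t$ ($t\ge3$) is the tree obtained by attaching to a single vertex $t$ pendant paths of lengths $k_1,\ldots,k_t$. The notation $T[a_1,a_i;a_j,a_k]$ denotes the starlike tree whose arm lengths are the terms of the unit arithmetic sequence $a_1,\ldots,a_k$ with all terms in the open interval $(a_i,a_j)$ removed. *)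

theory Defs
  imports "Graph_Theory.Graph_Theory" "HOL-Number_Theory.Cong"
begin

text \<open>Undirected graphs are the symmetric digraphs of \<open>Graph_Theory\<close>. The graph distance is the
  library's shortest-path distance for the unit weight; it is \<open>\<infinity>\<close> between different components,
  hence the type \<^typ>\<open>ereal\<close>.\<close>

definition graph_dist :: "('a, 'b) pre_digraph \<Rightarrow> 'a \<Rightarrow> 'a \<Rightarrow> ereal" where
  "graph_dist G u v = wf_digraph.\<mu> G (\<lambda>_. 1) u v"

definition transmission :: "('a, 'b) pre_digraph \<Rightarrow> 'a \<Rightarrow> ereal" where
  "transmission G v = (\<Sum>u\<in>verts G. graph_dist G u v)"

definition transmission_irregular :: "('a, 'b) pre_digraph \<Rightarrow> bool" where
  "transmission_irregular G \<longleftrightarrow> inj_on (transmission G) (verts G)"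

text \<open>\<open>Arm i j\<close> is the \<open>j\<close>-th vertex of the \<open>i\<close>-th pendant path, counted from the centre: arms are
  numbered from \<open>0\<close>, their vertices from \<open>1\<close>.\<close>

datatype starlike_vertex = Centre | Arm nat nat

definition starlike_verts :: "nat list \<Rightarrow> starlike_vertex set" where
  "starlike_verts ks = insert Centre {Arm i j | i j. i < length ks \<and> 1 \<le> j \<and> j \<le> ks ! i}"

text \<open>Each edge once, directed away from the centre.\<close>

definition starlike_edges :: "nat list \<Rightarrow> starlike_vertex rel" where
  "starlike_edges ks =
     {(Centre, Arm i 1) | i. i < length ks \<and> 1 \<le> ks ! i} \<union>
     {(Arm i j, Arm i (Suc j)) | i j. i < length ks \<and> 1 \<le> j \<and> Suc j \<le> ks ! i}"

definition starlike :: "nat list \<Rightarrow> starlike_vertex pair_pre_digraph" where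
  "starlike ks =
     \<lparr> pverts = starlike_verts ks, parcs = starlike_edges ks \<union> (starlike_edges ks)\<inverse> \<rparr>"

text \<open>\<open>starlike_gap a\<^sub>1 a\<^sub>i a\<^sub>j a\<^sub>k\<close> is \<open>T[a\<^sub>1,a\<^sub>i;a\<^sub>j,a\<^sub>k]\<close>.\<close>

definition gap_lengths :: "nat \<Rightarrow> nat \<Rightarrow> nat \<Rightarrow> nat \<Rightarrow> nat list" where
  "gap_lengths a1 ai aj ak = filter (\<lambda>x. \<not> (ai < x \<and> x < aj)) [a1..<Suc ak]"

definition starlike_gap :: "nat \<Rightarrow> nat \<Rightarrow> nat \<Rightarrow> nat \<Rightarrow> starlike_vertex pair_pre_digraph" where
  "starlike_gap a1 ai aj ak = starlike (gap_lengths a1 ai aj ak)"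

lemma gap_lengths_one_removed:
  assumes "k \<ge> 2"
  shows "gap_lengths a (a + k - 2) (a + k) (a + k + 1) = [a..<a + k - 1] @ [a + k, a + k + 1]"
proof -
  obtain m where k: "k = m + 2"
    using assms by (metis add.commute le_Suc_ex)
  have "[a..<Suc (a + k + 1)] = [a..<a + k - 1] @ [a + k - 1, a + k, a + k + 1]"
    by (simp add: k)
  moreover have "filter (\<lambda>x. \<not> (a + k - 2 < x \<and> x < a + k)) [a..<a + k - 1] = [a..<a + k - 1]"
    by (rule filter_True) (auto simp: k)
  ultimately show ?thesis
    by (simp add: gap_lengths_def k)
qed

lemma pair_graph_starlike: "pair_graph (starlike ks)"
proof -
  have verts: "starlike_verts ks = insert Centre ((\<lambda>(i, j). Arm i j) ` (SIGMA i:{..<length ks}. {1..ks ! i}))"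
    by (auto simp: starlike_verts_def)
  have fin: "finite (starlike_verts ks)"
    unfolding verts by simp
  have sub: "starlike_edges ks \<subseteq> starlike_verts ks \<times> starlike_verts ks"
    by (auto simp: starlike_edges_def starlike_verts_def)
  have "finite (starlike_edges ks)"
    using sub fin by (meson finite_SigmaI finite_subset)
  moreover have "symmetric (with_proj (starlike ks))"
    by (auto simp: symmetric_def starlike_def sym_def)
  moreover have "fst e \<noteq> snd e" if "e \<in> parcs (starlike ks)" for e
    using that by (auto simp: starlike_def starlike_edges_def)
  ultimately show ?thesis
    using sub fin by unfold_locales (auto simp: starlike_def)
qed

end

theory Submission
  imports Defs
begin

text \<open>Let \<open>N\<close> be the sum of the arm lengths. The transmission of the vertex at
  depth \<open>j\<close> on an arm of length \<open>l\<close> exceeds that of the centre by \<open>j (N - 2 l + j)\<close>.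
  Under the congruence hypothesis \<open>N\<close> is even, so if two arms of lengths \<open>l' < l\<close> give the same
  excess at depths \<open>j'\<close> and \<open>j\<close>, then \<open>j - j'\<close> is even, say \<open>2 d\<close> with \<open>d \<ge> 1\<close>. Equality becomes
  \<open>d (N - 2 l + j + j') = j' (l - l')\<close>, but already for \<open>d = 1\<close> the left-hand side is too large.\<close>

section \<open>Distances and transmissions in starlike trees\<close>

text \<open>\<open>D\<close> certifies distances to \<open>v\<close>. By \<open>step\<close> it
  drops by at most one along each arc, so a walk from \<open>u\<close> to \<open>v\<close> has at
  least \<open>D u\<close> arcs; following the arcs given by \<open>descent\<close> yields a walk
  with exactly \<open>D u\<close>. The infimum is thus attained.\<close>

lemma graph_dist_eqI:
  assumes "wf_digraph G" and "u \<in> verts G"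
    and target: "D v = 0"
    and step: "\<And>e. e \<in> arcs G \<Longrightarrow> D (tail G e) \<le> Suc (D (head G e))"
    and descent: "\<And>x. x \<in> verts G \<Longrightarrow> x \<noteq> v \<Longrightarrow> \<exists>e\<in>arcs G. tail G e = x \<and> D x = Suc (D (head G e))"
  shows "graph_dist G u v = ereal (real (D u))"
proof -
  interpret wf_digraph G by fact
  have lower: "D u \<le> length p" if "awalk u p v" for u p
    using that
  proof (induction p arbitrary: u)
    case Nil
    then show ?case by (simp add: awalk_Nil_iff target)
  next
    case (Cons e p)
    then have "e \<in> arcs G" "u = tail G e" "D (head G e) \<le> length p"
      by (auto simp: awalk_Cons_iff)
    then show ?case using step[of e] by simp
  qed
  have upper: "\<exists>p. awalk u p v \<and> length p = D u" if "u \<in> verts G" for u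
    using that
  proof (induction "D u" arbitrary: u)
    case 0
    then have "u = v" using descent[of u] by force
    with 0 show ?case by (intro exI[of _ "[]"]) (simp add: awalk_Nil_iff)
  next
    case (Suc n)
    then have "u \<noteq> v" using target by auto
    then obtain e where e: "e \<in> arcs G" "tail G e = u" "D u = Suc (D (head G e))"
      using descent Suc.prems by blast
    then obtain p where "awalk (head G e) p v" "length p = D (head G e)"
      using Suc by (metis Suc_inject head_in_verts)
    with e show ?case by (intro exI[of _ "e # p"]) (simp add: awalk_Cons_iff)
  qed
  have cost: "awalk_cost (\<lambda>_. 1) p = real (length p)" for p
    by (induction p) auto
  obtain p where p: "awalk u p v" "length p = D u"
    using upper assms(2) by blast
  show ?thesis
    unfolding graph_dist_def \<mu>_def
  proof (rule antisym)
    show "(INF p\<in>{p. awalk u p v}. ereal (awalk_cost (\<lambda>_. 1) p)) \<le> ereal (real (D u))"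
      by (rule INF_lower2[of p]) (use p in \<open>auto simp: cost\<close>)
    show "ereal (real (D u)) \<le> (INF p\<in>{p. awalk u p v}. ereal (awalk_cost (\<lambda>_. 1) p))"
      by (rule INF_greatest) (use lower in \<open>auto simp: cost\<close>)
  qed
qed

text \<open>Subtraction on naturals truncates at 0, so \<open>(j - j') + (j' - j)\<close> is the
  absolute difference of the depths.\<close>

fun starlike_dist :: "starlike_vertex \<Rightarrow> starlike_vertex \<Rightarrow> nat" where
  "starlike_dist Centre Centre = 0"
| "starlike_dist Centre (Arm i j) = j"
| "starlike_dist (Arm i j) Centre = j"
| "starlike_dist (Arm i j) (Arm i' j') = (if i = i' then (j - j') + (j' - j) else j + j')"

text \<open>Treating the centre as depth 0 of every arm merges the two kinds of edges.\<close>

lemma starlike_arc_outwards: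
  assumes "i < length ks" "j < ks ! i"
  shows "((if j = 0 then Centre else Arm i j), Arm i (Suc j)) \<in> starlike_edges ks"
  using assms by (auto simp: starlike_edges_def)

lemma starlike_dist_descent:
  assumes "x \<in> starlike_verts ks" "v \<in> starlike_verts ks" "x \<noteq> v"
  shows "\<exists>y. (x, y) \<in> starlike_edges ks \<union> (starlike_edges ks)\<inverse> \<and>
             starlike_dist x v = Suc (starlike_dist y v)"
proof (cases x)
  case Centre
  with assms obtain i j where "v = Arm i j" "i < length ks" "1 \<le> j" "j \<le> ks ! i"
    by (auto simp: starlike_verts_def)
  with Centre show ?thesis
    using starlike_arc_outwards[of i ks 0] by (intro exI[of _ "Arm i 1"]) auto
next
  case (Arm i j)
  with assms have ij: "i < length ks" "1 \<le> j" "j \<le> ks ! i"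
    by (auto simp: starlike_verts_def)
  show ?thesis
  \<comment> \<open>The shortest path leads outwards exactly when \<open>v\<close> lies further out
    on the same arm; in every other case it leads towards the centre.\<close>
  proof (cases "\<exists>j'. v = Arm i j' \<and> j < j'")
    case True
    then obtain j' where j': "v = Arm i j'" "j < j'" by blast
    with assms have "j' \<le> ks ! i" by (auto simp: starlike_verts_def)
    with Arm ij j' show ?thesis
      using starlike_arc_outwards[of i ks j] by (intro exI[of _ "Arm i (Suc j)"]) auto
  next
    case False
    let ?y = "if j = 1 then Centre else Arm i (j - 1)"
    have "(?y, Arm i j) \<in> starlike_edges ks"
      using starlike_arc_outwards[of i ks "j - 1"] ij by (auto split: if_splits)
    moreover have "starlike_dist x v = Suc (starlike_dist ?y v)"
      using False ij assms Arm by (cases v) (auto simp: starlike_verts_def)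
    ultimately show ?thesis using Arm by blast
  qed
qed

lemma starlike_dist_step:
  assumes "(x, y) \<in> starlike_edges ks \<union> (starlike_edges ks)\<inverse>"
  shows "starlike_dist x v \<le> Suc (starlike_dist y v)"
  using assms by (cases v) (auto simp: starlike_edges_def)

lemma graph_dist_starlike:
  assumes "u \<in> starlike_verts ks" "v \<in> starlike_verts ks"
  shows "graph_dist (with_proj (starlike ks)) u v = ereal (real (starlike_dist u v))"
proof (rule graph_dist_eqI[where D = "\<lambda>x. starlike_dist x v"])
  interpret pair_graph "starlike ks" by (rule pair_graph_starlike)
  show "wf_digraph (with_proj (starlike ks))" by unfold_locales
  show "starlike_dist v v = 0" by (cases v) auto
  show "\<exists>e\<in>arcs (starlike ks). tail (starlike ks) e = x \<and>
          starlike_dist x v = Suc (starlike_dist (head (starlike ks) e) v)"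
    if "x \<in> verts (starlike ks)" "x \<noteq> v" for x
    using starlike_dist_descent[of x ks v] that assms by (force simp: starlike_def)
  show "starlike_dist (tail (starlike ks) e) v \<le> Suc (starlike_dist (head (starlike ks) e) v)"
    if "e \<in> arcs (starlike ks)" for e
    using that starlike_dist_step[of "fst e" "snd e" ks v] by (simp add: starlike_def)
qed (use assms in \<open>simp add: starlike_def\<close>)

lemma sum_starlike_verts:
  fixes f :: "starlike_vertex \<Rightarrow> 'a::comm_monoid_add"
  shows "(\<Sum>u\<in>starlike_verts ks. f u) = f Centre + (\<Sum>i<length ks. \<Sum>j=1..ks ! i. f (Arm i j))"
proof -
  let ?S = "SIGMA i:{..<length ks}. {1..ks ! i}"
  have verts: "starlike_verts ks = insert Centre ((\<lambda>(i, j). Arm i j) ` ?S)"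
    by (auto simp: starlike_verts_def)
  have "inj_on (\<lambda>(i, j). Arm i j) ?S"
    by (auto simp: inj_on_def)
  then have "(\<Sum>u\<in>(\<lambda>(i, j). Arm i j) ` ?S. f u) = (\<Sum>(i, j)\<in>?S. f (Arm i j))"
    by (simp add: sum.reindex case_prod_unfold)
  also have "\<dots> = (\<Sum>i<length ks. \<Sum>j=1..ks ! i. f (Arm i j))"
    by (subst sum.Sigma) auto
  finally show ?thesis
    unfolding verts by (subst sum.insert) auto
qed

text \<open>Integer values make differences of transmissions available without infinities or
  truncation.\<close>

definition starlike_transmission :: "nat list \<Rightarrow> starlike_vertex \<Rightarrow> int" where
  "starlike_transmission ks v = (\<Sum>u\<in>starlike_verts ks. int (starlike_dist u v))"

lemma transmission_starlike:
  assumes "v \<in> starlike_verts ks"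
  shows "transmission (with_proj (starlike ks)) v = ereal (of_int (starlike_transmission ks v))"
proof -
  have "transmission (with_proj (starlike ks)) v
          = (\<Sum>u\<in>starlike_verts ks. ereal (real (starlike_dist u v)))"
    unfolding transmission_def
    by (rule sum.cong) (use assms graph_dist_starlike in \<open>auto simp: starlike_def\<close>)
  then show ?thesis by (simp add: starlike_transmission_def)
qed

text \<open>The own arm's share of the excess over the centre. Depths up to \<open>j\<close>
  contribute \<open>j - 2 * j'\<close> each, in total \<open>- j\<close>; each of the
  \<open>l - j\<close> deeper vertices is closer by \<open>j\<close>.\<close>

lemma sum_own_arm_differences:
  assumes "j \<le> l"
  shows "(\<Sum>j'=1..l. int ((j' - j) + (j - j')) - int j') = - int j - (int l - int j) * int j"
  using assms
proof (induction l rule: dec_induct)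
  case base
  have "(\<Sum>j'=1..j. int ((j' - j) + (j - j')) - int j') = (\<Sum>j'=1..j. int j - 2 * int j')"
    by (rule sum.cong) auto
  also have "\<dots> = - int j"
  proof -
    \<comment> \<open>The constant \<open>c\<close> is decoupled from the upper limit so that the
      induction varies \<open>m\<close> alone; both are then set to \<open>j\<close>.\<close>
    have "(\<Sum>j'=1..m. c - 2 * int j') = int m * c - int m * (int m + 1)" for m c
      by (induction m) (auto simp: algebra_simps)
    from this[of "int j" j] show ?thesis by (simp only:) (simp add: algebra_simps)
  qed
  finally show ?case by simp
next
  case (step l)
  then show ?case by (simp add: algebra_simps of_nat_diff)
qed

text \<open>Every vertex off arm \<open>i\<close> is further by \<open>j\<close> from
  \<open>Arm i j\<close> than from the centre. The own arm enters as a correction to this uniform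
  count, so that the arm lengths add up to \<open>sum_list ks\<close>.\<close>

lemma starlike_transmission_Arm:
  assumes "i < length ks" "j \<le> ks ! i"
  shows "starlike_transmission ks (Arm i j) - starlike_transmission ks Centre
           = int j * (int (sum_list ks) - 2 * int (ks ! i) + int j)"
proof -
  let ?f = "\<lambda>u. int (starlike_dist u (Arm i j)) - int (starlike_dist u Centre)"
  have arm: "(\<Sum>j'=1..ks ! i'. ?f (Arm i' j'))
               = int (ks ! i') * int j - (if i' = i then int j + (2 * int (ks ! i) - int j) * int j else 0)"
    for i'
  proof (cases "i' = i")
    case True
    then show ?thesis
      using sum_own_arm_differences[OF assms(2)] by (simp add: algebra_simps)
  qed simp
  have "starlike_transmission ks (Arm i j) - starlike_transmission ks Centre
          = (\<Sum>u\<in>starlike_verts ks. ?f u)"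
    by (simp add: starlike_transmission_def sum_subtractf)
  also have "\<dots> = int j + (\<Sum>i'<length ks. \<Sum>j'=1..ks ! i'. ?f (Arm i' j'))"
    by (subst sum_starlike_verts) simp
  also have "\<dots> = int j + int (sum_list ks) * int j - (int j + (2 * int (ks ! i) - int j) * int j)"
    unfolding arm using assms(1)
    by (simp add: sum_subtractf sum_distrib_right sum_list_sum_nth atLeast0LessThan)
  finally show ?thesis by (simp add: algebra_simps)
qed

text \<open>Transmissions are compared through their excess over the centre. \<open>pos\<close>
  makes the excess strictly increasing in the depth, which separates the vertices of one arm from
  each other and from the centre; \<open>neq\<close> separates arms of different lengths, and by
  distinctness these are all pairs of arms.\<close>

lemma transmission_irregular_starlikeI:
  assumes "distinct ks"
    and pos: "\<And>l. l \<in> set ks \<Longrightarrow> 2 * l \<le> sum_list ks"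
    and neq: "\<And>l l' j j'. \<lbrakk>l \<in> set ks; l' \<in> set ks; l' < l; 1 \<le> j; j \<le> l; 1 \<le> j'; j' \<le> l'\<rbrakk> \<Longrightarrow>
      int j * (int (sum_list ks) - 2 * int l + int j) \<noteq> int j' * (int (sum_list ks) - 2 * int l' + int j')"
  shows "transmission_irregular (with_proj (starlike ks))"
proof -
  let ?N = "int (sum_list ks)"
  define g where "g l j = int j * (?N - 2 * int l + int j)" for l j
  define T where "T v = starlike_transmission ks v - starlike_transmission ks Centre" for v
  have T_Arm: "T (Arm i j) = g (ks ! i) j" if "i < length ks" "j \<le> ks ! i" for i j
    using starlike_transmission_Arm[OF that] by (simp add: T_def g_def)
  have g_mono: "g l j < g l j'" if "l \<in> set ks" "j < j'" for l j j'
    unfolding g_def using pos[OF that(1)] that(2)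
    by (intro mult_strict_mono') auto
  \<comment> \<open>Depth 0 stands for the centre: \<open>g l 0\<close> is 0.\<close>
  have T_pos: "T (Arm i j) > 0" if "i < length ks" "1 \<le> j" "j \<le> ks ! i" for i j
    using g_mono[of "ks ! i" 0 j] that by (simp add: T_Arm) (simp add: g_def)
  have g_inj: "l = l' \<and> j = j'"
    if "l \<in> set ks" "l' \<in> set ks" "1 \<le> j" "j \<le> l" "1 \<le> j'" "j' \<le> l'" "g l j = g l' j'" for l l' j j'
    using neq[of l l' j j'] neq[of l' l j' j] g_mono[of l j j'] g_mono[of l j' j] that
    unfolding g_def[symmetric] by (metis less_irrefl linorder_less_linear)
  have "inj_on T (starlike_verts ks)"
  proof (rule inj_onI)
    fix u v assume u: "u \<in> starlike_verts ks" and v: "v \<in> starlike_verts ks" and eq: "T u = T v"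
    have T0: "T Centre = 0" by (simp add: T_def)
    show "u = v"
    proof (cases u; cases v)
      fix i j i' j' assume uv: "u = Arm i j" "v = Arm i' j'"
      with u v have b: "i < length ks" "1 \<le> j" "j \<le> ks ! i" "i' < length ks" "1 \<le> j'" "j' \<le> ks ! i'"
        by (auto simp: starlike_verts_def)
      then have "ks ! i = ks ! i' \<and> j = j'"
        using eq uv by (intro g_inj) (auto simp: T_Arm)
      then show ?thesis
        using uv b assms(1) by (auto simp: nth_eq_iff_index_eq)
    qed (use u v eq T0 T_pos in \<open>force simp: starlike_verts_def\<close>)+
  qed
  then have "inj_on (starlike_transmission ks) (starlike_verts ks)"
    by (simp add: inj_on_def T_def)
  then show ?thesis
    unfolding transmission_irregular_def
    by (simp add: starlike_def inj_on_def)
      (simp add: transmission_starlike[unfolded starlike_def])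
qed

section \<open>Arithmetic of the arm lengths\<close>

lemma sum_list_upt_add: "2 * int (sum_list [a..<a + n]) = 2 * int n * int a + int n * (int n - 1)"
  by (induction n) (auto simp: algebra_simps)

text \<open>\<open>N\<close> is the sum of the \<open>k + 1\<close> arm lengths, doubled to avoid a
  division. The worst case is the longest arm, \<open>l = a + k + 1\<close>, where the doubled slack
  splits into products of nonnegative factors.\<close>

lemma double_arm_le_sum:
  fixes a k N l :: int
  assumes "a \<ge> 1" "k \<ge> 2" and N: "2 * N = 2 * (k + 1) * a + k\<^sup>2 + k + 4" and "l \<le> a + k + 1"
  shows "2 * l \<le> N"
proof -
  have "0 \<le> 2 * ((k - 1) * (a - 1)) + (k - 2) * (k + 1)"
    using assms by (intro add_nonneg_nonneg mult_nonneg_nonneg) auto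
  also have "\<dots> = 2 * N - 4 * (a + k + 1)"
    unfolding N by (simp add: algebra_simps power2_eq_square)
  finally show ?thesis using assms(4) by simp
qed

text \<open>The closing estimate for two arms whose lengths differ by \<open>e\<close>. With
  \<open>g\<close> measuring how far \<open>e\<close> is below its maximum \<open>k + 1\<close>,
  twice the gap between the sides becomes a sum of nonnegative terms plus the positive term
  \<open>g + 2\<close>.\<close>

lemma arm_difference_bound:
  fixes a k N e :: int
  assumes "a \<ge> 1" and N: "2 * N = 2 * (k + 1) * a + k\<^sup>2 + k + 4" and "e \<le> k + 1"
  shows "e * (a + k + 3 - e) < N + 2"
proof -
  define g where "g = k + 1 - e"
  define u where "u = k - g"
  have e: "e = k + 1 - g" by (simp add: g_def)
  have "0 \<le> g" using assms by (simp add: g_def)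
  \<comment> \<open>No integer lies strictly between 1 and 2.\<close>
  moreover have "0 \<le> (u - 1) * (u - 2)"
    by (cases "u \<le> 1") (auto intro: mult_nonneg_nonneg mult_nonpos_nonpos)
  ultimately have "0 < 2 * (g * (a - 1)) + ((u - 1) * (u - 2) + (g\<^sup>2 + (g + 2)))"
    using assms by (intro add_nonneg_pos) auto
  also have "\<dots> = 2 * (N + 2) - 2 * (e * (a + k + 3 - e))"
    unfolding distrib_left N u_def e by (simp add: algebra_simps power2_eq_square)
  finally show ?thesis by simp
qed

lemma arm_excess_neq:
  fixes a k N l l' j j' :: int
  assumes a: "a \<ge> 1" and k: "k \<ge> 2" and N: "2 * N = 2 * (k + 1) * a + k\<^sup>2 + k + 4" and "even N"
    and l: "a \<le> l'" "l' < l" "l \<le> a + k + 1" and j: "1 \<le> j" and j': "1 \<le> j'" "j' \<le> l'"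
  shows "j * (N - 2 * l + j) \<noteq> j' * (N - 2 * l' + j')"
proof
  assume eq: "j * (N - 2 * l + j) = j' * (N - 2 * l' + j')"
  have Nl: "2 * l \<le> N" using double_arm_le_sum[OF a k N] l by simp
  \<comment> \<open>For even \<open>N\<close> each product is congruent to the square of its depth
    modulo 2.\<close>
  have "even (j * (N - 2 * l + j)) \<longleftrightarrow> even j" "even (j' * (N - 2 * l' + j')) \<longleftrightarrow> even j'"
    using \<open>even N\<close> by auto
  with eq have "even (j - j')" by simp
  then obtain d where d: "j = j' + 2 * d" by (metis add.commute diff_add_cancel evenE)
  define e where "e = l - l'"
  have key: "d * (N - 2 * l + 2 * j' + 2 * d) = j' * e"
    using eq unfolding d e_def by (simp add: algebra_simps)
  have "1 \<le> e" using l by (simp add: e_def)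
  have s: "0 < N - 2 * l + 2 * j' + 2 * d" using d j j' Nl by linarith
  have "0 < d * (N - 2 * l + 2 * j' + 2 * d)"
    unfolding key using j' \<open>1 \<le> e\<close> by simp
  then have "1 \<le> d" using s by (simp add: zero_less_mult_iff)
  \<comment> \<open>Both factors grow with \<open>d\<close>, so \<open>d = 1\<close> gives the
    weakest requirement.\<close>
  then have "1 * (N - 2 * l + 2 * j' + 2 * 1) \<le> d * (N - 2 * l + 2 * j' + 2 * d)"
    using j' Nl by (intro mult_mono) auto
  then have le: "N - 2 * l + 2 \<le> j' * (e - 2)"
    unfolding key by (simp add: algebra_simps)
  \<comment> \<open>Makes \<open>e - 2\<close> nonnegative, so that \<open>j'\<close> can be
    replaced below by its upper bound \<open>l' = l - e\<close>.\<close>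
  have "2 \<le> e"
  proof (rule ccontr)
    assume "\<not> 2 \<le> e"
    then have "e = 1" using \<open>1 \<le> e\<close> by simp
    with le j' Nl show False by simp
  qed
  then have "j' * (e - 2) \<le> (l - e) * (e - 2)"
    using j' by (intro mult_right_mono) (auto simp: e_def)
  with le have "N + 2 \<le> e * (l + 2 - e)"
    by (simp add: algebra_simps)
  also have "\<dots> \<le> e * (a + k + 3 - e)"
    using l \<open>1 \<le> e\<close> by (intro mult_left_mono) auto
  also have "\<dots> < N + 2"
    \<comment> \<open>Both lengths lie between \<open>a\<close> and \<open>a + k + 1\<close>, whence
      \<open>e \<le> k + 1\<close>.\<close>
    using arm_difference_bound[OF a N] l by (simp add: e_def)
  finally show False by simp
qed

text \<open>Solving the congruence for \<open>k\<close> and substituting exhibits \<open>N\<close>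
  as twice an integer; in the second case the terms in the square of \<open>a\<close>
  cancel.\<close>

lemma even_sum_arm_lengths:
  fixes a k N :: int
  assumes N: "2 * N = 2 * (k + 1) * a + k\<^sup>2 + k + 4"
    and "[k = 3] (mod 4) \<or> [k + 2 * a = 0] (mod 4)"
  shows "even N"
  using assms(2)
proof
  assume "[k = 3] (mod 4)"
  then obtain m where "k = 3 + 4 * m" by (metis cong_iff_lin cong_sym)
  then have "N = 2 * (2 * (m + 1) * a + 4 * m\<^sup>2 + 7 * m + 4)"
    using N by (simp add: algebra_simps power2_eq_square)
  then show ?thesis by simp
next
  assume "[k + 2 * a = 0] (mod 4)"
  then obtain m where "k + 2 * a = 4 * m" by (metis cong_0_iff dvdE)
  then have k: "k = 4 * m - 2 * a" by simp
  have "N = 2 * (4 * m\<^sup>2 - 2 * m * a + m + 1)"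
    using N unfolding k by (simp add: algebra_simps power2_eq_square)
  then show ?thesis by simp
qed

theorem theorem3p1:
  fixes a k :: nat
  assumes "a \<ge> 1" and "k \<ge> 2"
    and "[k = 3] (mod 4) \<or> [k + 2 * a = 0] (mod 4)"
  shows "transmission_irregular (with_proj (starlike_gap a (a + k - 2) (a + k) (a + k + 1)))"
proof -
  define ks where "ks = [a..<a + k - 1] @ [a + k, a + k + 1]"
  have ks: "gap_lengths a (a + k - 2) (a + k) (a + k + 1) = ks"
    unfolding ks_def by (rule gap_lengths_one_removed) fact
  have bounds: "a \<le> l \<and> l \<le> a + k + 1" if "l \<in> set ks" for l
    using that \<open>k \<ge> 2\<close> by (auto simp: ks_def)
  \<comment> \<open>The \<open>k - 1\<close> arms before the gap form an arithmetic series; the arms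
    \<open>a + k\<close> and \<open>a + k + 1\<close> supply the rest of \<open>N\<close>.\<close>
  have "2 * int (sum_list [a..<a + (k - 1)]) = 2 * int (k - 1) * int a + int (k - 1) * (int (k - 1) - 1)"
    by (rule sum_list_upt_add)
  then have N: "2 * int (sum_list ks) = 2 * (int k + 1) * int a + (int k)\<^sup>2 + int k + 4"
    using \<open>k \<ge> 2\<close> by (simp add: ks_def of_nat_diff algebra_simps power2_eq_square)
  have "[int k = 3] (mod 4) \<or> [int k + 2 * int a = 0] (mod 4)"
    using assms(3) cong_int_iff[of k 3 4] cong_int_iff[of "k + 2 * a" 0 4] by simp
  with N have even: "even (int (sum_list ks))"
    by (rule even_sum_arm_lengths)
  have "2 * l \<le> sum_list ks" if "l \<in> set ks" for l
    using double_arm_le_sum[OF _ _ N, of "int l"] assms bounds[OF that] by simp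
  moreover have "int j * (int (sum_list ks) - 2 * int l + int j)
                   \<noteq> int j' * (int (sum_list ks) - 2 * int l' + int j')"
    if "l \<in> set ks" "l' \<in> set ks" "l' < l" "1 \<le> j" "1 \<le> j'" "j' \<le> l'" for l l' j j'
    by (rule arm_excess_neq[OF _ _ N even])
      (use assms bounds[OF that(1)] bounds[OF that(2)] that in auto)
  moreover have "distinct ks" by (auto simp: ks_def)
  ultimately show ?thesis
    unfolding starlike_gap_def ks by (intro transmission_irregular_starlikeI) blast+
qed

end
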